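(* Let $A$ be a subpositive operator on the $w^*$-sequentially complete anti-dual pair $\langle F,E\rangle$, with Krein--von Neumann extension $A_N$. Let $B\in\mathscr{L}(E;F)$ be a positive operator such that $A_N\leq B$. Then there exists a positive operator $A_{max}^B\in\mathscr{L}(E;F)$, $A_{max}^B\leq B$, such that for every positive extension $\widetilde A\in\mathscr{L}(E;F)$ of $A$ with $0\leq\widetilde A\leq B$ one has $\widetilde A\leq A_{max}^B$. In other words, $$A_{max}^B=\max\{\widetilde A\in\mathscr{L}(E;F) : 0\leq\widetilde A\leq B,\ A\subset\widetilde A\}$$ (in particular $A_{max}^B$ itself extends $A$). Furthermore, a positive operator $0\leq\widetilde A\leq B$ is an extension of $A$ if and only if $A_N\leq\widetilde A\leq A_{max}^B$, that is, $$\{\widetilde A\in\mathscr{L}(E;F): A_N\leq\widetilde A\leq A_{max}^B\}=\{\widetilde A\in\mathscr{L}(E;F) : 0\leq\widetilde A\leq B,\ A\subset\widetilde A\}.$$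
   Context: An anti-dual pair $\langle F,E\rangle$ consists of complex vector spaces $E,F$ and a map $\langle\cdot,\cdot\rangle:F\times E\to\mathbb{C}$, linear in the first and conjugate linear in the second variable, which separates points of both spaces ($\langle f,x\rangle=0$ for all $x\in E$ implies $f=0$; $\langle f,x\rangle=0$ for all $f\in F$ implies $x=0$). $\sigma(E,F)$ and $\sigma(F,E)$ are the smallest topologies on $E$, resp. $F$, making all maps $x\mapsto\langle f,x\rangle$ ($f\in F$), resp. $f\mapsto\langle f,x\rangle$ ($x\in E$), continuous. The pair is $w^*$-sequentially complete if $(F,\sigma(F,E))$ is sequentially complete. $\mathscr{L}(E;F)$ denotes the set of everywhere defined $\sigma(E,F)$-$\sigma(F,E)$ continuous linear operators $E\to F$. A linear operator $A:E\supseteq\operatorname{dom}A\to F$ is positive if $\langle Ax,x\rangle\geq 0$ for all $x\in\operatorname{dom}A$. For $S,T\in\mathscr{L}(E;F)$, $S\leq T$ means $\langle (T-S)x,x\rangle\geq 0$ for all $x\in E$. $A\subset\widetilde A$ means that $\widetilde A$ extends $A$. A linear operator $A$ from a linear subspace $\operatorname{dom}A\subseteq E$ to $F$ is subpositive if it has a positive extension in $\mathscr{L}(E;F)$; equivalently, for every $y\in E$ there is $M_y\geq0$ with $|\langle Ax,y\rangle|^2\leq M_y\langle Ax,x\rangle$ for all $x\in\operatorname{dom}A$. Every subpositive operator on a $w^*$-sequentially complete anti-dual pair has a smallest positive extension in $\mathscr{L}(E;F)$ with respect to $\leq$; it is called the Krein--von Neumann extension and denoted $A_N$. *)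

theory Defs
  imports "HOL-Analysis.Analysis"
begin

text \<open>
  Complex vector spaces are given by \<open>vector_space scale\<close> with \<open>scale :: complex \<Rightarrow> 'a \<Rightarrow> 'a\<close>, so no
  norm or topology is attached to the types. An anti-dual pair has its own two scalar
  multiplications, and the value of the pairing at \<open>f \<in> F\<close>, \<open>x \<in> E\<close> is written \<open>pair f x\<close>.
\<close>

locale anti_dual_pair =
  E: vector_space scaleE + F: vector_space scaleF
  for scaleE :: "complex \<Rightarrow> 'e::ab_group_add \<Rightarrow> 'e"
    and scaleF :: "complex \<Rightarrow> 'f::ab_group_add \<Rightarrow> 'f" +
  fixes pair :: "'f \<Rightarrow> 'e \<Rightarrow> complex"
  assumes pair_add_left: "pair (f + g) x = pair f x + pair g x"
    and pair_scale_left: "pair (scaleF c f) x = c * pair f x"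
    and pair_add_right: "pair f (x + y) = pair f x + pair f y"
    and pair_scale_right: "pair f (scaleE c x) = cnj c * pair f x"
    and separates_left: "(\<And>x. pair f x = 0) \<Longrightarrow> f = 0"
    and separates_right: "(\<And>f. pair f x = 0) \<Longrightarrow> x = 0"

definition sigma_EF :: "('f \<Rightarrow> 'e \<Rightarrow> complex) \<Rightarrow> 'e topology" where
  "sigma_EF pair = topology_generated_by {(\<lambda>x. pair f x) -` U | f U. open U}"

definition sigma_FE :: "('f \<Rightarrow> 'e \<Rightarrow> complex) \<Rightarrow> 'f topology" where
  "sigma_FE pair = topology_generated_by {(\<lambda>f. pair f x) -` U | x U. open U}"

text \<open>Cauchy sequences are those of the translation-invariant uniformity of the topological
  vector space \<open>F\<close>.\<close>

definition w_star_Cauchy :: "('f::ab_group_add \<Rightarrow> 'e \<Rightarrow> complex) \<Rightarrow> (nat \<Rightarrow> 'f) \<Rightarrow> bool" where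
  "w_star_Cauchy pair s \<longleftrightarrow>
     (\<forall>U. openin (sigma_FE pair) U \<and> 0 \<in> U \<longrightarrow> (\<exists>N. \<forall>m\<ge>N. \<forall>n\<ge>N. s m - s n \<in> U))"

definition w_star_sequentially_complete :: "('f::ab_group_add \<Rightarrow> 'e \<Rightarrow> complex) \<Rightarrow> bool" where
  "w_star_sequentially_complete pair \<longleftrightarrow>
     (\<forall>s. w_star_Cauchy pair s \<longrightarrow> (\<exists>f. limitin (sigma_FE pair) s f sequentially))"

definition continuous_operators ::
  "(complex \<Rightarrow> 'e::ab_group_add \<Rightarrow> 'e) \<Rightarrow> (complex \<Rightarrow> 'f::ab_group_add \<Rightarrow> 'f)
     \<Rightarrow> ('f \<Rightarrow> 'e \<Rightarrow> complex) \<Rightarrow> ('e \<Rightarrow> 'f) set" where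
  "continuous_operators scaleE scaleF pair =
     {T. Vector_Spaces.linear scaleE scaleF T \<and> continuous_map (sigma_EF pair) (sigma_FE pair) T}"

text \<open>A partially defined operator is a domain \<open>D\<close> with a total function \<open>A\<close>; the values of \<open>A\<close>
  outside \<open>D\<close> are irrelevant.\<close>

definition linear_operator_on ::
  "(complex \<Rightarrow> 'e::ab_group_add \<Rightarrow> 'e) \<Rightarrow> (complex \<Rightarrow> 'f::ab_group_add \<Rightarrow> 'f)
     \<Rightarrow> 'e set \<Rightarrow> ('e \<Rightarrow> 'f) \<Rightarrow> bool" where
  "linear_operator_on scaleE scaleF D A \<longleftrightarrow>
     module.subspace scaleE D \<and>
     (\<forall>x\<in>D. \<forall>y\<in>D. A (x + y) = A x + A y) \<and>
     (\<forall>c. \<forall>x\<in>D. A (scaleE c x) = scaleF c (A x))"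

definition extends :: "'e set \<Rightarrow> ('e \<Rightarrow> 'f) \<Rightarrow> ('e \<Rightarrow> 'f) \<Rightarrow> bool" where
  "extends D A T \<longleftrightarrow> (\<forall>x\<in>D. T x = A x)"

text \<open>Membership in \<open>\<real>\<^sub>\<ge>\<^sub>0\<close> says that the complex number is real and nonnegative.\<close>

definition positive_on :: "('f \<Rightarrow> 'e \<Rightarrow> complex) \<Rightarrow> 'e set \<Rightarrow> ('e \<Rightarrow> 'f) \<Rightarrow> bool" where
  "positive_on pair D A \<longleftrightarrow> (\<forall>x\<in>D. pair (A x) x \<in> \<real>\<^sub>\<ge>\<^sub>0)"

definition op_le :: "('f::ab_group_add \<Rightarrow> 'e \<Rightarrow> complex) \<Rightarrow> ('e \<Rightarrow> 'f) \<Rightarrow> ('e \<Rightarrow> 'f) \<Rightarrow> bool" where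
  "op_le pair S T \<longleftrightarrow> (\<forall>x. pair (T x - S x) x \<in> \<real>\<^sub>\<ge>\<^sub>0)"

definition is_least_op ::
  "('f::ab_group_add \<Rightarrow> 'e \<Rightarrow> complex) \<Rightarrow> ('e \<Rightarrow> 'f) set \<Rightarrow> ('e \<Rightarrow> 'f) \<Rightarrow> bool" where
  "is_least_op pair \<S> T \<longleftrightarrow> T \<in> \<S> \<and> (\<forall>S\<in>\<S>. op_le pair T S)"

definition is_greatest_op ::
  "('f::ab_group_add \<Rightarrow> 'e \<Rightarrow> complex) \<Rightarrow> ('e \<Rightarrow> 'f) set \<Rightarrow> ('e \<Rightarrow> 'f) \<Rightarrow> bool" where
  "is_greatest_op pair \<S> T \<longleftrightarrow> T \<in> \<S> \<and> (\<forall>S\<in>\<S>. op_le pair S T)"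

definition positive_extensions ::
  "(complex \<Rightarrow> 'e::ab_group_add \<Rightarrow> 'e) \<Rightarrow> (complex \<Rightarrow> 'f::ab_group_add \<Rightarrow> 'f)
     \<Rightarrow> ('f \<Rightarrow> 'e \<Rightarrow> complex) \<Rightarrow> 'e set \<Rightarrow> ('e \<Rightarrow> 'f) \<Rightarrow> ('e \<Rightarrow> 'f) set" where
  "positive_extensions scaleE scaleF pair D A =
     {T \<in> continuous_operators scaleE scaleF pair. positive_on pair UNIV T \<and> extends D A T}"

definition subpositive ::
  "(complex \<Rightarrow> 'e::ab_group_add \<Rightarrow> 'e) \<Rightarrow> (complex \<Rightarrow> 'f::ab_group_add \<Rightarrow> 'f)
     \<Rightarrow> ('f \<Rightarrow> 'e \<Rightarrow> complex) \<Rightarrow> 'e set \<Rightarrow> ('e \<Rightarrow> 'f) \<Rightarrow> bool" where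
  "subpositive scaleE scaleF pair D A \<longleftrightarrow>
     linear_operator_on scaleE scaleF D A \<and> positive_extensions scaleE scaleF pair D A \<noteq> {}"

text \<open>The order is antisymmetric on linear operators (by polarization), so a smallest positive
  extension is unique; it exists for a subpositive operator on a \<open>w\<^sup>*\<close>-sequentially complete pair.\<close>

definition krein_von_neumann ::
  "(complex \<Rightarrow> 'e::ab_group_add \<Rightarrow> 'e) \<Rightarrow> (complex \<Rightarrow> 'f::ab_group_add \<Rightarrow> 'f)
     \<Rightarrow> ('f \<Rightarrow> 'e \<Rightarrow> complex) \<Rightarrow> 'e set \<Rightarrow> ('e \<Rightarrow> 'f) \<Rightarrow> ('e \<Rightarrow> 'f)" where
  "krein_von_neumann scaleE scaleF pair D A =
     (THE T. is_least_op pair (positive_extensions scaleE scaleF pair D A) T)"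

end

theory Submission
  imports Defs
begin

text \<open>
  The map \<open>T \<mapsto> B - T\<close> reverses the order on the operators between \<open>0\<close> and \<open>B\<close> and exchanges the
  extensions of \<open>A\<close> with those of \<open>(B - A)|D\<close>, so the maximum is \<open>B - (B - A)\<^sub>N\<close>. An operator \<open>T\<close>
  between \<open>A\<^sub>N\<close> and the maximum extends \<open>A\<close> because \<open>\<langle>(T - A\<^sub>N)x, x\<rangle> = 0\<close> forces
  \<open>(T - A\<^sub>N)x = 0\<close> by Cauchy--Schwarz.

  For the existence of \<open>A\<^sub>N\<close>, let \<open>T\<close> be a positive extension of \<open>A\<close> and \<open>q x = \<langle>Tx, x\<rangle>\<close>. Given
  \<open>y\<close>, a sequence \<open>x\<^sub>n\<close> in \<open>D\<close> minimizing \<open>q (y - x\<^sub>n)\<close> is \<open>q\<close>-Cauchy, hence \<open>A x\<^sub>n\<close> is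
  \<open>w\<^sup>*\<close>-Cauchy, and its limit is \<open>A\<^sub>N y\<close>. Continuity comes for free: a positive operator is symmetric,
  and symmetric everywhere defined operators are continuous.
\<close>

section \<open>Algebra of the pairing, the weak topologies and weak continuity\<close>

context anti_dual_pair
begin

lemma pair_zero_left [simp]: "pair 0 x = 0"
  using pair_add_left[of 0 0 x] by simp

lemma pair_zero_right [simp]: "pair f 0 = 0"
  using pair_add_right[of f 0 0] by simp

lemma pair_diff_left: "pair (f - g) x = pair f x - pair g x"
  using pair_add_left[of "f - g" g x] by simp

lemma pair_diff_right: "pair f (x - y) = pair f x - pair f y"
  using pair_add_right[of f "x - y" y] by simp

lemma linear_operatorI:
  assumes "\<And>x y. T (x + y) = T x + T y" "\<And>c x. T (scaleE c x) = scaleF c (T x)"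
  shows "Vector_Spaces.linear scaleE scaleF T"
  using assms E.vector_space_axioms F.vector_space_axioms by (simp add: Vector_Spaces.linear_iff)

lemma linear_operatorD:
  assumes "Vector_Spaces.linear scaleE scaleF T"
  shows "T (x + y) = T x + T y" "T (scaleE c x) = scaleF c (T x)"
  using assms by (simp_all add: Vector_Spaces.linear_iff)

lemma linear_operator_diff:
  assumes "Vector_Spaces.linear scaleE scaleF S" "Vector_Spaces.linear scaleE scaleF T"
  shows "Vector_Spaces.linear scaleE scaleF (\<lambda>x. S x - T x)"
  by (rule linear_operatorI)
    (simp_all add: linear_operatorD[OF assms(1)] linear_operatorD[OF assms(2)]
      F.scale_right_diff_distrib)

lemma openin_sigma_FE: "open U \<Longrightarrow> openin (sigma_FE pair) ((\<lambda>f. pair f x) -` U)"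
  unfolding sigma_FE_def by (intro topology_generated_by_Basis) blast

lemma openin_sigma_EF: "open U \<Longrightarrow> openin (sigma_EF pair) ((\<lambda>x. pair f x) -` U)"
  unfolding sigma_EF_def by (intro topology_generated_by_Basis) blast

lemma topspace_sigma_EF: "topspace (sigma_EF pair) = UNIV"
  using openin_subset[OF openin_sigma_EF[OF open_UNIV]] by auto

lemma limitin_sigma_FE_imp:
  assumes "limitin (sigma_FE pair) s f sequentially"
  shows "(\<lambda>n. pair (s n) x) \<longlonglongrightarrow> pair f x"
proof (rule topological_tendstoI)
  fix U :: "complex set" assume "open U" "pair f x \<in> U"
  with assms openin_sigma_FE[of U x] show "eventually (\<lambda>n. pair (s n) x \<in> U) sequentially"
    unfolding limitin_def by auto
qed

text \<open>By induction on how a neighbourhood of 0 is generated: an intersection takes the larger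
  of two thresholds, a union uses one member containing 0, and a subbasic set reduces to a ball
  around 0 in the complex plane.\<close>

lemma w_star_CauchyI:
  assumes "\<And>x. Cauchy (\<lambda>n. pair (s n) x)"
  shows "w_star_Cauchy pair s"
proof -
  have "\<exists>N. \<forall>m\<ge>N. \<forall>n\<ge>N. s m - s n \<in> U"
    if "generate_topology_on {(\<lambda>f. pair f x) -` U | x U. open U} U" "0 \<in> U" for U
    using that
  proof (induction rule: generate_topology_on.induct)
    case Empty
    then show ?case by simp
  next
    case (Int a b)
    then obtain M N where "\<forall>m\<ge>M. \<forall>n\<ge>M. s m - s n \<in> a" "\<forall>m\<ge>N. \<forall>n\<ge>N. s m - s n \<in> b"
      by auto
    then have "\<forall>m\<ge>max M N. \<forall>n\<ge>max M N. s m - s n \<in> a \<inter> b" by auto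
    then show ?case by blast
  next
    case (UN K)
    then show ?case by blast
  next
    case (Basis a)
    then obtain x V where V: "a = (\<lambda>f. pair f x) -` V" "open V" "0 \<in> V" by auto
    then obtain e where e: "e > 0" "ball 0 e \<subseteq> V" by (meson open_contains_ball)
    obtain N where N: "\<forall>m\<ge>N. \<forall>n\<ge>N. dist (pair (s m) x) (pair (s n) x) < e"
      using assms[of x] e(1) unfolding Cauchy_def by blast
    have "s m - s n \<in> a" if "m \<ge> N" "n \<ge> N" for m n
    proof -
      have "pair (s m - s n) x \<in> ball 0 e"
        using N that by (simp add: pair_diff_left dist_norm norm_minus_commute)
      then show ?thesis using e V by auto
    qed
    then show ?case by blast
  qed
  then show ?thesis
    unfolding w_star_Cauchy_def sigma_FE_def openin_topology_generated_by_iff by blast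
qed

text \<open>Symmetry makes \<open>pair (T y) x\<close>, as a function of \<open>y\<close>, the
  conjugate of \<open>pair (T x) y\<close>, which is weakly continuous in \<open>y\<close> by
  construction. Hence preimages of subbasic sets are subbasic.\<close>

lemma continuous_operator_if_symmetric:
  assumes "Vector_Spaces.linear scaleE scaleF T"
    and sym: "\<And>x y. pair (T x) y = cnj (pair (T y) x)"
  shows "T \<in> continuous_operators scaleE scaleF pair"
proof -
  have "continuous_map (sigma_EF pair) (sigma_FE pair) T"
    unfolding sigma_FE_def
  proof (rule continuous_on_generated_topo)
    fix U assume "U \<in> {(\<lambda>f. pair f x) -` U | x U. open U}"
    then obtain x V where V: "U = (\<lambda>f. pair f x) -` V" "open V" by auto
    have "open (cnj -` V)" by (intro open_vimage V continuous_intros)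
    moreover have "T -` U = (\<lambda>y. pair (T x) y) -` (cnj -` V)"
      unfolding V using sym[of _ x] by auto
    ultimately show "openin (sigma_EF pair) (T -` U \<inter> topspace (sigma_EF pair))"
      using openin_sigma_EF by (simp add: topspace_sigma_EF)
  qed (use open_UNIV in blast)
  with assms show ?thesis unfolding continuous_operators_def by simp
qed

end

section \<open>Positive operators and their quadratic forms\<close>

locale positive_operator = anti_dual_pair scaleE scaleF pair
  for scaleE :: "complex \<Rightarrow> 'e::ab_group_add \<Rightarrow> 'e"
    and scaleF :: "complex \<Rightarrow> 'f::ab_group_add \<Rightarrow> 'f"
    and pair :: "'f \<Rightarrow> 'e \<Rightarrow> complex" +
  fixes T :: "'e \<Rightarrow> 'f"
  assumes linear: "Vector_Spaces.linear scaleE scaleF T"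
    and positive: "positive_on pair UNIV T"
begin

lemmas map_add = linear_operatorD(1)[OF linear]
lemmas map_scale = linear_operatorD(2)[OF linear]

lemma map_diff: "T (x - y) = T x - T y"
  using map_add[of "x - y" y] by (simp add: algebra_simps)

text \<open>Polarization: since the form is real at \<open>x + y\<close>, the imaginary parts are
  opposite; since it is real at \<open>x + scaleE \<i> y\<close>, the real parts agree.\<close>

lemma symmetric: "pair (T x) y = cnj (pair (T y) x)"
proof -
  have real: "Im (pair (T z) z) = 0" for z
    using positive unfolding positive_on_def by (auto simp: complex_nonneg_Reals_iff)
  have "Im (pair (T x) y) + Im (pair (T y) x) = 0"
    using real[of "x + y"] real[of x] real[of y] by (simp add: map_add pair_add_left pair_add_right)
  moreover have "Re (pair (T y) x) = Re (pair (T x) y)"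
    using real[of "x + scaleE \<i> y"] real[of x] real[of y]
    by (simp add: map_add map_scale pair_add_left pair_add_right pair_scale_left pair_scale_right)
  ultimately show ?thesis by (simp add: complex_eq_iff)
qed

lemma continuous: "T \<in> continuous_operators scaleE scaleF pair"
  using linear symmetric by (rule continuous_operator_if_symmetric)

text \<open>The squared seminorm of the semi-inner product \<open>pair (T x) y\<close>. Taking the
  real part only changes the type, by \<open>pair_self\<close>.\<close>

definition q :: "'e \<Rightarrow> real" where "q x = Re (pair (T x) x)"

lemma pair_self: "pair (T x) x = of_real (q x)"
  using positive unfolding positive_on_def q_def
  by (auto simp: complex_nonneg_Reals_iff complex_eq_iff)

lemma q_nonneg [simp]: "q x \<ge> 0"
  using positive unfolding positive_on_def q_def by (auto simp: complex_nonneg_Reals_iff)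

lemma q_diff: "q (x - y) = q x - 2 * Re (pair (T x) y) + q y"
  using symmetric[of x y] unfolding q_def
  by (simp add: map_diff pair_diff_left pair_diff_right)

lemma q_add: "q (x + y) = q x + 2 * Re (pair (T x) y) + q y"
  using symmetric[of x y] unfolding q_def
  by (simp add: map_add pair_add_left pair_add_right)

lemma q_scale: "q (scaleE c x) = (cmod c)\<^sup>2 * q x"
  unfolding q_def map_scale pair_scale_left pair_scale_right
  by (simp add: pair_self cmod_power2) (simp add: power2_eq_square algebra_simps)

text \<open>For \<open>\<delta> = 0\<close> this is the Cauchy--Schwarz inequality; for \<open>\<delta>\<close> the infimum of \<open>q\<close> over the
  coset \<open>u + D\<close> it says that an almost minimal \<open>u\<close> is almost orthogonal to \<open>D\<close>.\<close>

lemma almost_orthogonal: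
  assumes "\<And>c. q (u - scaleE c d) \<ge> \<delta>"
  shows "(cmod (pair (T u) d))\<^sup>2 \<le> (q u - \<delta>) * q d"
proof -
  define k where "k = (cmod (pair (T u) d))\<^sup>2"
  have ineq: "0 \<le> (q u - \<delta>) - 2 * t * k + t\<^sup>2 * k * q d" for t :: real
  proof -
    \<comment> \<open>The factor \<open>pair (T u) d\<close> rotates the cross term onto the real
      axis, leaving a real polynomial in \<open>t\<close>.\<close>
    have "Re (pair (T u) (scaleE (of_real t * pair (T u) d) d)) = t * k"
      unfolding pair_scale_right k_def cmod_power2 by (simp add: power2_eq_square algebra_simps)
    moreover have "q (scaleE (of_real t * pair (T u) d) d) = t\<^sup>2 * k * q d"
      by (simp add: q_scale k_def norm_mult power_mult_distrib)
    ultimately show ?thesis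
      using assms[of "of_real t * pair (T u) d"] q_diff[of u "scaleE (of_real t * pair (T u) d) d"]
      by simp
  qed
  have "k \<le> (q u - \<delta>) * q d"
  proof (cases "q d = 0")
    case True
    have "k = 0"
    proof (rule ccontr)
      assume "k \<noteq> 0"
      \<comment> \<open>Without its quadratic term the polynomial is affine in \<open>t\<close>, and
        this value of \<open>t\<close> makes it equal to -1.\<close>
      with ineq[of "(q u - \<delta> + 1) / (2 * k)"] True show False by simp
    qed
    with True show ?thesis by simp
  next
    case False
    then have "q d > 0" using q_nonneg[of d] by linarith
    \<comment> \<open>For \<open>k > 0\<close> this \<open>t\<close> is the minimizer of the
      quadratic polynomial.\<close>
    with ineq[of "1 / q d"] show ?thesis by (simp add: field_simps power2_eq_square)
  qed
  then show ?thesis by (simp add: k_def)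
qed

lemma Cauchy_Schwarz: "cmod (pair (T x) y) \<le> sqrt (q x) * sqrt (q y)"
  using almost_orthogonal[of 0 x y] by (simp add: real_le_rsqrt flip: real_sqrt_mult)

lemma eq_0_if_q_eq_0: "T x = 0" if "q x = 0"
  using Cauchy_Schwarz[of x] that by (intro separates_left) simp

section \<open>Projections with respect to \<open>q\<close>, represented by elements of
  \<open>F\<close>\<close>

lemma sqrt_q_le:
  assumes "q x \<le> sqrt (q x) * c" "c \<ge> 0"
  shows "sqrt (q x) \<le> c"
proof (cases "sqrt (q x) = 0")
  case False
  then have "sqrt (q x) > 0" using q_nonneg[of x] by (simp add: less_le)
  moreover have "sqrt (q x) * sqrt (q x) \<le> sqrt (q x) * c" using assms(1) by simp
  ultimately show ?thesis by (rule mult_left_le_imp_le[rotated])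
qed (use assms(2) in simp)

text \<open>In the Hilbert space completion of \<open>E\<close> with respect to \<open>q\<close>, this relation says that \<open>f\<close>
  represents the orthogonal projection of \<open>y\<close> onto the closure of \<open>D\<close>.\<close>

definition represents_projection :: "'e set \<Rightarrow> 'e \<Rightarrow> 'f \<Rightarrow> bool" where
  "represents_projection D y f \<longleftrightarrow>
     (\<forall>d\<in>D. pair f d = pair (T y) d) \<and>
     (\<forall>e>0. \<exists>x\<in>D. \<forall>z. cmod (pair (T x - f) z) \<le> e * sqrt (q z))"

lemma represents_projection_in:
  assumes "y \<in> D"
  shows "represents_projection D y (T y)"
  unfolding represents_projection_def using assms by (auto intro!: bexI[of _ y])

lemma represents_projection_add:
  assumes "E.subspace D" "represents_projection D y f" "represents_projection D z g"
  shows "represents_projection D (y + z) (f + g)"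
  unfolding represents_projection_def
proof (intro conjI ballI allI impI)
  fix d assume "d \<in> D"
  then show "pair (f + g) d = pair (T (y + z)) d"
    using assms by (simp add: represents_projection_def pair_add_left map_add)
next
  fix e :: real assume "e > 0"
  then obtain u v where uv: "u \<in> D" "v \<in> D"
    "\<And>w. cmod (pair (T u - f) w) \<le> e/2 * sqrt (q w)" "\<And>w. cmod (pair (T v - g) w) \<le> e/2 * sqrt (q w)"
    using assms unfolding represents_projection_def by (meson half_gt_zero)
  have "cmod (pair (T (u + v) - (f + g)) w) \<le> e * sqrt (q w)" for w
  proof -
    have "pair (T (u + v) - (f + g)) w = pair (T u - f) w + pair (T v - g) w"
      by (simp add: map_add pair_add_left pair_diff_left)
    then have "cmod (pair (T (u + v) - (f + g)) w) \<le> cmod (pair (T u - f) w) + cmod (pair (T v - g) w)"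
      using norm_triangle_ineq by metis
    then show ?thesis using uv(3,4)[of w] by simp
  qed
  then show "\<exists>x\<in>D. \<forall>w. cmod (pair (T x - (f + g)) w) \<le> e * sqrt (q w)"
    using E.subspace_add[OF assms(1) uv(1,2)] by blast
qed

lemma represents_projection_scale:
  assumes "E.subspace D" "represents_projection D y f"
  shows "represents_projection D (scaleE c y) (scaleF c f)"
  unfolding represents_projection_def
proof (intro conjI ballI allI impI)
  fix d assume "d \<in> D"
  then show "pair (scaleF c f) d = pair (T (scaleE c y)) d"
    using assms by (simp add: represents_projection_def pair_scale_left map_scale)
next
  fix e :: real assume "e > 0"
  \<comment> \<open>Adding 1 keeps the denominator positive when \<open>c = 0\<close>.\<close>
  then have "e / (cmod c + 1) > 0" by (simp add: add_nonneg_pos)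
  then obtain u where u: "u \<in> D" "\<And>w. cmod (pair (T u - f) w) \<le> e / (cmod c + 1) * sqrt (q w)"
    using assms unfolding represents_projection_def by meson
  have "cmod (pair (T (scaleE c u) - scaleF c f) w) \<le> e * sqrt (q w)" for w
  proof -
    have "cmod (pair (T (scaleE c u) - scaleF c f) w) = cmod c * cmod (pair (T u - f) w)"
      by (simp add: map_scale pair_diff_left pair_scale_left norm_mult flip: right_diff_distrib)
    also have "\<dots> \<le> cmod c * (e / (cmod c + 1) * sqrt (q w))"
      using u(2) by (intro mult_left_mono) auto
    also have "\<dots> = (cmod c / (cmod c + 1)) * (e * sqrt (q w))" by simp
    also have "\<dots> \<le> 1 * (e * sqrt (q w))"
      using \<open>e > 0\<close> by (intro mult_right_mono) (auto simp: divide_le_eq_1 add_nonneg_pos)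
    finally show ?thesis by simp
  qed
  then show "\<exists>x\<in>D. \<forall>w. cmod (pair (T x - scaleF c f) w) \<le> e * sqrt (q w)"
    using E.subspace_scale[OF assms(1) u(1)] by blast
qed

text \<open>Such an \<open>f\<close> vanishes on \<open>D\<close>. Testing \<open>T x - f\<close>
  against its own approximant \<open>x\<close> therefore bounds \<open>sqrt (q x)\<close> by
  \<open>e\<close>, so that \<open>T x\<close>, and with it \<open>f\<close>, is small as a
  functional.\<close>

lemma represents_projection_zero:
  assumes "represents_projection D 0 f"
  shows "f = 0"
proof (rule separates_left)
  fix z
  have T0: "T 0 = 0" using map_diff[of 0 0] by simp
  have "cmod (pair f z) \<le> 2 * sqrt (q z) * e" if "e > 0" for e
  proof -
    from assms that obtain x where x: "x \<in> D" "\<And>w. cmod (pair (T x - f) w) \<le> e * sqrt (q w)"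
      unfolding represents_projection_def by blast
    have "pair f x = 0" using assms x(1) T0 unfolding represents_projection_def by simp
    then have "q x \<le> sqrt (q x) * e"
      using x(2)[of x] by (simp add: pair_diff_left pair_self mult.commute)
    then have "sqrt (q x) \<le> e" using that by (intro sqrt_q_le) auto
    have "cmod (pair f z) \<le> cmod (pair (T x) z) + cmod (pair (T x - f) z)"
      using norm_triangle_ineq4[of "pair (T x) z" "pair (T x - f) z"] by (simp add: pair_diff_left)
    also have "\<dots> \<le> sqrt (q x) * sqrt (q z) + e * sqrt (q z)"
      using Cauchy_Schwarz[of x z] x(2)[of z] by simp
    also have "\<dots> \<le> e * sqrt (q z) + e * sqrt (q z)"
      using \<open>sqrt (q x) \<le> e\<close> by (intro add_mono mult_right_mono) auto
    finally show ?thesis by (simp add: algebra_simps)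
  qed
  moreover have "((\<lambda>e. 2 * sqrt (q z) * e) \<longlongrightarrow> 2 * sqrt (q z) * 0) (at_right 0)"
    by (intro tendsto_intros)
  ultimately have "cmod (pair f z) \<le> 2 * sqrt (q z) * 0"
    by (intro tendsto_lowerbound[where F = "at_right (0::real)"])
      (auto simp: eventually_at_filter)
  then show "pair f z = 0" by simp
qed

text \<open>The relation is linear, so the difference of two representatives represents the
  projection of 0.\<close>

lemma represents_projection_unique:
  assumes "E.subspace D" "represents_projection D y f" "represents_projection D y g"
  shows "f = g"
proof -
  have "represents_projection D (y + scaleE (-1) y) (f + scaleF (-1) g)"
    using assms by (intro represents_projection_add represents_projection_scale)
  then have "f + scaleF (-1) g = 0" by (intro represents_projection_zero[of D]) simp
  then show ?thesis by simp
qed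

section \<open>Approximating sequences, positivity and minimality of projections\<close>

lemma represents_projection_sequence:
  assumes "represents_projection D y f"
  obtains x where "\<And>n. x n \<in> D" "(\<lambda>n. pair (T (x n)) y) \<longlonglongrightarrow> pair f y"
    "(\<lambda>n. complex_of_real (q (x n))) \<longlonglongrightarrow> pair f y"
proof -
  let ?e = "\<lambda>n. inverse (real (Suc n))"
  have "\<exists>x\<in>D. \<forall>z. cmod (pair (T x - f) z) \<le> ?e n * sqrt (q z)" for n
    using assms unfolding represents_projection_def by simp
  then obtain x where x: "\<And>n. x n \<in> D" "\<And>n z. cmod (pair (T (x n) - f) z) \<le> ?e n * sqrt (q z)"
    by metis
  have lim: "(\<lambda>n. ?e n * c) \<longlonglongrightarrow> 0" for c
    using tendsto_mult_right[OF LIMSEQ_inverse_real_of_nat, of c] by (simp add: mult.commute)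
  have "(\<lambda>n. pair (T (x n)) y - pair f y) \<longlonglongrightarrow> 0"
    using x(2)[of _ y]
    by (intro Lim_null_comparison[OF _ lim[of "sqrt (q y)"]]) (auto simp: pair_diff_left)
  then have 1: "(\<lambda>n. pair (T (x n)) y) \<longlonglongrightarrow> pair f y" by (simp add: LIM_zero_iff)
  \<comment> \<open>The error of approximation is relative to the seminorm of the test vector.
    Testing with \<open>x n\<close> itself, as is done next, therefore requires a uniform bound on
    its seminorm.\<close>
  have bound: "sqrt (q (x n)) \<le> sqrt (q y) + 1" for n
  proof -
    have "pair f (x n) = pair (T y) (x n)"
      using assms x(1) unfolding represents_projection_def by simp
    then have "q (x n) \<le> cmod (pair (T y) (x n)) + cmod (pair (T (x n) - f) (x n))"
      using norm_triangle_ineq[of "pair (T y) (x n)" "pair (T (x n) - f) (x n)"]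
      by (simp add: pair_diff_left pair_self)
    also have "\<dots> \<le> sqrt (q y) * sqrt (q (x n)) + ?e n * sqrt (q (x n))"
      using Cauchy_Schwarz x(2) by (intro add_mono)
    also have "\<dots> \<le> sqrt (q y) * sqrt (q (x n)) + 1 * sqrt (q (x n))"
      by (intro add_mono mult_right_mono) (auto simp: field_simps)
    also have "\<dots> = sqrt (q (x n)) * (sqrt (q y) + 1)" by (simp add: algebra_simps)
    finally show ?thesis by (intro sqrt_q_le) auto
  qed
  have "cmod (of_real (q (x n)) - pair (T y) (x n)) \<le> ?e n * (sqrt (q y) + 1)" for n
  proof -
    have "of_real (q (x n)) - pair (T y) (x n) = pair (T (x n) - f) (x n)"
      using assms x(1) unfolding represents_projection_def by (simp add: pair_diff_left pair_self)
    then have "cmod (of_real (q (x n)) - pair (T y) (x n)) \<le> ?e n * sqrt (q (x n))"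
      using x(2) by metis
    also have "\<dots> \<le> ?e n * (sqrt (q y) + 1)"
      by (intro mult_left_mono bound) auto
    finally show ?thesis .
  qed
  then have "(\<lambda>n. of_real (q (x n)) - pair (T y) (x n)) \<longlonglongrightarrow> 0"
    by (intro Lim_null_comparison[OF _ lim[of "sqrt (q y) + 1"]]) auto
  \<comment> \<open>Conjugation and symmetry turn \<open>pair (T y) (x n)\<close> into
    \<open>pair (T (x n)) y\<close>, whose limit is known.\<close>
  then have "(\<lambda>n. cnj (of_real (q (x n)) - pair (T y) (x n))) \<longlonglongrightarrow> 0"
    using tendsto_cnj by fastforce
  moreover have "cnj (of_real (q (x n)) - pair (T y) (x n)) = of_real (q (x n)) - pair (T (x n)) y" for n
    using symmetric[of "x n" y] by simp
  ultimately have "(\<lambda>n. of_real (q (x n)) - pair (T (x n)) y) \<longlonglongrightarrow> 0" by simp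
  from tendsto_add[OF this 1] have "(\<lambda>n. complex_of_real (q (x n))) \<longlonglongrightarrow> pair f y" by simp
  with x(1) 1 show thesis by (rule that)
qed

lemma represents_projection_nonneg:
  assumes "represents_projection D y f"
  shows "pair f y \<in> \<real>\<^sub>\<ge>\<^sub>0"
proof -
  obtain x where "(\<lambda>n. complex_of_real (q (x n))) \<longlonglongrightarrow> pair f y"
    using represents_projection_sequence[OF assms] by blast
  then show ?thesis
    by (rule Lim_in_closed_set[OF closed_nonneg_Reals_complex, rotated -1])
      (auto simp: complex_nonneg_Reals_iff)
qed

text \<open>On \<open>D\<close> the forms of \<open>S\<close> and \<open>T\<close> coincide, so
  Cauchy--Schwarz for \<open>S\<close> bounds \<open>pair (T (x n)) y\<close> by
  \<open>sqrt (q (x n)) * sqrt (S.q y)\<close>. With \<open>a = pair f y\<close>, the limit gives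
  \<open>a \<le> sqrt a * sqrt (S.q y)\<close>, and one factor \<open>sqrt a\<close>
  cancels.\<close>

lemma represents_projection_minimal:
  assumes "represents_projection D y f" "positive_operator scaleE scaleF pair S"
    "\<And>x. x \<in> D \<Longrightarrow> S x = T x"
  shows "pair (S y - f) y \<in> \<real>\<^sub>\<ge>\<^sub>0"
proof -
  interpret S: positive_operator scaleE scaleF pair S by fact
  obtain x where x: "\<And>n. x n \<in> D" "(\<lambda>n. pair (T (x n)) y) \<longlonglongrightarrow> pair f y"
    "(\<lambda>n. complex_of_real (q (x n))) \<longlonglongrightarrow> pair f y"
    using represents_projection_sequence[OF assms(1)] by blast
  define a where "a = Re (pair f y)"
  have a: "pair f y = of_real a" "a \<ge> 0"
    using represents_projection_nonneg[OF assms(1)]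
    by (auto simp: a_def complex_nonneg_Reals_iff complex_eq_iff)
  have "(\<lambda>n. q (x n)) \<longlonglongrightarrow> a" using tendsto_Re[OF x(3)] by (simp add: a_def)
  then have "(\<lambda>n. sqrt (q (x n)) * sqrt (S.q y)) \<longlonglongrightarrow> sqrt a * sqrt (S.q y)"
    by (intro tendsto_intros)
  moreover have "(\<lambda>n. cmod (pair (T (x n)) y)) \<longlonglongrightarrow> a" using tendsto_norm[OF x(2)] a by simp
  moreover have "cmod (pair (T (x n)) y) \<le> sqrt (q (x n)) * sqrt (S.q y)" for n
    using S.Cauchy_Schwarz[of "x n" y] assms(3) x(1) by (simp add: S.q_def q_def)
  ultimately have "a \<le> sqrt a * sqrt (S.q y)" by (intro LIMSEQ_le) auto
  moreover have "a = sqrt a * sqrt a" using a by simp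
  ultimately have "sqrt a * sqrt a \<le> sqrt a * sqrt (S.q y)" by linarith
  then have "a \<le> S.q y"
    using a(2) S.q_nonneg[of y] by (cases "a = 0") (auto simp: mult_le_cancel_left simp del: real_sqrt_mult_self)
  then show ?thesis by (simp add: pair_diff_left a S.pair_self complex_nonneg_Reals_iff)
qed

section \<open>Existence of projections from sequential completeness\<close>

lemma represents_projection_exists:
  assumes "w_star_sequentially_complete pair" "E.subspace D"
  shows "\<exists>f. represents_projection D y f"
proof -
  let ?e = "\<lambda>n. inverse (real (Suc n))"
  define \<delta> where "\<delta> = (INF x\<in>D. q (y - x))"
  have "D \<noteq> {}" using E.subspace_0[OF assms(2)] by blast
  have bdd: "bdd_below ((\<lambda>x. q (y - x)) ` D)" by (rule bdd_belowI[of _ 0]) auto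
  have \<delta>: "\<delta> \<le> q (y - x)" if "x \<in> D" for x
    unfolding \<delta>_def using bdd that by (rule cINF_lower)
  have "\<exists>x\<in>D. q (y - x) < \<delta> + ?e n" for n
    using cINF_less_iff[OF \<open>D \<noteq> {}\<close> bdd, of "\<delta> + ?e n"] unfolding \<delta>_def by simp
  then obtain x where x: "\<And>n. x n \<in> D" "\<And>n. q (y - x n) < \<delta> + ?e n" by metis
  have dist: "q (x n - x m) \<le> 2 * ?e n + 2 * ?e m" for m n
  proof -
    \<comment> \<open>The parallelogram law; the midpoint of \<open>x m\<close> and
      \<open>x n\<close> lies in \<open>D\<close>, so the second term on the left is at least
      \<open>4 * \<delta>\<close>.\<close>
    have "q ((y - x m) - (y - x n)) + q ((y - x m) + (y - x n)) = 2 * q (y - x m) + 2 * q (y - x n)"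
      by (simp only: q_diff[of "y - x m"] q_add[of "y - x m"])
    moreover have "(y - x m) - (y - x n) = x n - x m" by simp
    moreover have "(y - x m) + (y - x n) = scaleE 2 (y - scaleE (1/2) (x m + x n))"
      using E.scale_left_distrib[of 1 1 y] by (simp add: E.scale_right_diff_distrib)
    then have "q ((y - x m) + (y - x n)) = 4 * q (y - scaleE (1/2) (x m + x n))"
      by (simp only: q_scale) simp
    moreover have "\<delta> \<le> q (y - scaleE (1/2) (x m + x n))"
      by (intro \<delta> E.subspace_scale E.subspace_add assms x)
    ultimately show ?thesis using x(2)[of m] x(2)[of n] by simp
  qed
  have close: "cmod (pair (T (x n) - T (x m)) z) \<le> sqrt (2 * ?e n + 2 * ?e m) * sqrt (q z)" for m n z
  proof -
    have "cmod (pair (T (x n) - T (x m)) z) \<le> sqrt (q (x n - x m)) * sqrt (q z)"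
      using Cauchy_Schwarz[of "x n - x m" z] by (simp only: map_diff)
    also have "\<dots> \<le> sqrt (2 * ?e n + 2 * ?e m) * sqrt (q z)"
      using dist by (intro mult_right_mono real_sqrt_le_mono) auto
    finally show ?thesis .
  qed
  have e_lim: "?e \<longlonglongrightarrow> 0" by (rule LIMSEQ_inverse_real_of_nat)
  have "Cauchy (\<lambda>n. pair (T (x n)) z)" for z
  proof (rule metric_CauchyI)
    fix r :: real assume "r > 0"
    have "(\<lambda>n. sqrt (4 * ?e n) * sqrt (q z)) \<longlonglongrightarrow> sqrt (4 * 0) * sqrt (q z)"
      by (intro tendsto_intros e_lim)
    with \<open>r > 0\<close> have "eventually (\<lambda>n. sqrt (4 * ?e n) * sqrt (q z) < r) sequentially"
      by (intro order_tendstoD) auto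
    then obtain N where N: "sqrt (4 * ?e N) * sqrt (q z) < r" by (auto simp: eventually_sequentially)
    have "dist (pair (T (x m)) z) (pair (T (x n)) z) < r" if "m \<ge> N" "n \<ge> N" for m n
    proof -
      have "?e m \<le> ?e N" "?e n \<le> ?e N" using that by (auto intro!: le_imp_inverse_le)
      then have "2 * ?e m + 2 * ?e n \<le> 4 * ?e N" by linarith
      then have "sqrt (2 * ?e m + 2 * ?e n) \<le> sqrt (4 * ?e N)" by (rule real_sqrt_le_mono)
      then have "sqrt (2 * ?e m + 2 * ?e n) * sqrt (q z) \<le> sqrt (4 * ?e N) * sqrt (q z)"
        by (intro mult_right_mono) auto
      with close[of m n z] N show ?thesis by (simp add: dist_norm pair_diff_left)
    qed
    then show "\<exists>N. \<forall>m\<ge>N. \<forall>n\<ge>N. dist (pair (T (x m)) z) (pair (T (x n)) z) < r" by blast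
  qed
  then have "w_star_Cauchy pair (\<lambda>n. T (x n))" by (rule w_star_CauchyI)
  then obtain f where "limitin (sigma_FE pair) (\<lambda>n. T (x n)) f sequentially"
    using assms(1) unfolding w_star_sequentially_complete_def by blast
  then have f: "(\<lambda>n. pair (T (x n)) z) \<longlonglongrightarrow> pair f z" for z by (rule limitin_sigma_FE_imp)
  \<comment> \<open>Letting \<open>m\<close> tend to infinity in \<open>close\<close> for each fixed
    \<open>z\<close> retains the uniform dependence on \<open>sqrt (q z)\<close>, although
    \<open>T (x m)\<close> converges only weakly.\<close>
  have f_close: "cmod (pair (T (x n) - f) z) \<le> sqrt (2 * ?e n) * sqrt (q z)" for n z
  proof (rule LIMSEQ_le)
    show "(\<lambda>m. cmod (pair (T (x n) - T (x m)) z)) \<longlonglongrightarrow> cmod (pair (T (x n) - f) z)"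
      unfolding pair_diff_left by (intro tendsto_intros f)
    have "(\<lambda>m. sqrt (2 * ?e n + 2 * ?e m) * sqrt (q z)) \<longlonglongrightarrow> sqrt (2 * ?e n + 2 * 0) * sqrt (q z)"
      by (intro tendsto_intros e_lim)
    then show "(\<lambda>m. sqrt (2 * ?e n + 2 * ?e m) * sqrt (q z)) \<longlonglongrightarrow> sqrt (2 * ?e n) * sqrt (q z)"
      by simp
  qed (use close in blast)
  have "represents_projection D y f"
    unfolding represents_projection_def
  proof (intro conjI ballI allI impI)
    fix d assume d: "d \<in> D"
    \<comment> \<open>The residual \<open>y - x n\<close> minimizes \<open>q\<close> on its coset
      modulo \<open>D\<close> up to \<open>?e n\<close>, hence is almost orthogonal to
      \<open>d\<close>.\<close>
    have near: "cmod (pair (T (x n)) d - pair (T y) d) \<le> sqrt (?e n * q d)" for n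
    proof -
      have "(cmod (pair (T (y - x n)) d))\<^sup>2 \<le> (q (y - x n) - \<delta>) * q d"
      proof (rule almost_orthogonal)
        show "\<delta> \<le> q (y - x n - scaleE c d)" for c
          using \<delta>[of "x n + scaleE c d"] E.subspace_add[OF assms(2) x(1) E.subspace_scale[OF assms(2) d]]
          by (simp add: diff_diff_eq)
      qed
      also have "\<dots> \<le> ?e n * q d"
        using x(2)[of n] by (intro mult_right_mono) auto
      finally have "cmod (pair (T (y - x n)) d) \<le> sqrt (?e n * q d)" by (rule real_le_rsqrt)
      then show ?thesis by (simp only: map_diff pair_diff_left norm_minus_commute)
    qed
    have "(\<lambda>n. sqrt (?e n * q d)) \<longlonglongrightarrow> sqrt (0 * q d)"
      by (intro tendsto_intros e_lim)
    then have "(\<lambda>n. sqrt (?e n * q d)) \<longlonglongrightarrow> 0" by simp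
    with always_eventually[of _ sequentially, OF allI, OF near]
    have "(\<lambda>n. pair (T (x n)) d - pair (T y) d) \<longlonglongrightarrow> 0"
      by (rule Lim_null_comparison)
    then have "(\<lambda>n. pair (T (x n)) d) \<longlonglongrightarrow> pair (T y) d" by (simp add: LIM_zero_iff)
    with f[of d] show "pair f d = pair (T y) d" by (rule LIMSEQ_unique)
  next
    fix r :: real assume "r > 0"
    have "(\<lambda>n. sqrt (2 * ?e n)) \<longlonglongrightarrow> sqrt (2 * 0)" by (intro tendsto_intros e_lim)
    with \<open>r > 0\<close> have "eventually (\<lambda>n. sqrt (2 * ?e n) < r) sequentially"
      by (intro order_tendstoD) auto
    then obtain n where n: "sqrt (2 * ?e n) < r" by (auto simp: eventually_sequentially)
    have "cmod (pair (T (x n) - f) z) \<le> r * sqrt (q z)" for z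
      using f_close[of n z] mult_right_mono[OF less_imp_le[OF n], of "sqrt (q z)"] by simp
    with x(1) show "\<exists>x\<in>D. \<forall>z. cmod (pair (T x - f) z) \<le> r * sqrt (q z)" by blast
  qed
  then show ?thesis by blast
qed

end

section \<open>The order on operators and the Krein--von Neumann extension\<close>

context anti_dual_pair
begin

lemma positive_operator_iff:
  "positive_operator scaleE scaleF pair T \<longleftrightarrow>
     T \<in> continuous_operators scaleE scaleF pair \<and> positive_on pair UNIV T"
proof
  assume "positive_operator scaleE scaleF pair T"
  then interpret positive_operator scaleE scaleF pair T .
  show "T \<in> continuous_operators scaleE scaleF pair \<and> positive_on pair UNIV T"
    using continuous positive ..
qed (simp add: positive_operator_def positive_operator_axioms_def anti_dual_pair_axioms
    continuous_operators_def)

lemma positive_extensions_iff: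
  "T \<in> positive_extensions scaleE scaleF pair D A \<longleftrightarrow>
     positive_operator scaleE scaleF pair T \<and> extends D A T"
  by (auto simp: positive_extensions_def positive_operator_iff)

lemma positive_operator_diff:
  assumes "S \<in> continuous_operators scaleE scaleF pair" "T \<in> continuous_operators scaleE scaleF pair"
    "op_le pair S T"
  shows "positive_operator scaleE scaleF pair (\<lambda>x. T x - S x)"
  using assms anti_dual_pair_axioms linear_operator_diff
  by (simp add: positive_operator_def positive_operator_axioms_def continuous_operators_def
      op_le_def positive_on_def)

lemma op_le_trans:
  assumes "op_le pair R S" "op_le pair S T"
  shows "op_le pair R T"
  unfolding op_le_def
proof
  fix x
  have "pair (T x - R x) x = pair (T x - S x) x + pair (S x - R x) x" by (simp add: pair_diff_left)
  then show "pair (T x - R x) x \<in> \<real>\<^sub>\<ge>\<^sub>0"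
    using assms by (simp add: op_le_def nonneg_Reals_add_I)
qed

lemma op_le_antisym:
  assumes "S \<in> continuous_operators scaleE scaleF pair" "T \<in> continuous_operators scaleE scaleF pair"
    and "op_le pair S T" "op_le pair T S"
  shows "S = T"
proof
  fix x
  interpret positive_operator scaleE scaleF pair "\<lambda>x. T x - S x"
    by (rule positive_operator_diff) fact+
  have "q x = 0"
    using assms(3,4) unfolding q_def op_le_def
    by (auto simp: complex_nonneg_Reals_iff pair_diff_left intro: antisym)
  then show "S x = T x" using eq_0_if_q_eq_0[of x] by simp
qed

text \<open>Any positive extension \<open>T\<close> supplies the form, and \<open>K y\<close>
  represents the projection of \<open>y\<close> onto \<open>D\<close>. Uniqueness of representatives
  makes \<open>K\<close> linear and gives \<open>K y = T y\<close> on \<open>D\<close>; minimality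
  holds against every positive extension, not just \<open>T\<close>.\<close>

lemma krein_von_neumann_exists:
  assumes "w_star_sequentially_complete pair" "subpositive scaleE scaleF pair D A"
  shows "\<exists>K. is_least_op pair (positive_extensions scaleE scaleF pair D A) K"
proof -
  obtain T where T: "positive_operator scaleE scaleF pair T" "extends D A T"
    using assms(2) by (auto simp: subpositive_def positive_extensions_iff)
  interpret positive_operator scaleE scaleF pair T by fact
  have D: "E.subspace D" using assms(2) by (simp add: subpositive_def linear_operator_on_def)
  obtain K where K: "\<And>y. represents_projection D y (K y)"
    using represents_projection_exists[OF assms(1) D] by metis
  have lin: "Vector_Spaces.linear scaleE scaleF K"
    using D K by (intro linear_operatorI represents_projection_unique[OF D K]
        represents_projection_add represents_projection_scale)
  then have "positive_operator scaleE scaleF pair K"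
    using represents_projection_nonneg[OF K] anti_dual_pair_axioms
    by (simp add: positive_operator_def positive_operator_axioms_def positive_on_def)
  moreover have "extends D A K"
    using T(2) represents_projection_unique[OF D K represents_projection_in]
    by (simp add: extends_def)
  moreover have "op_le pair K S" if "S \<in> positive_extensions scaleE scaleF pair D A" for S
    using that T(2) represents_projection_minimal[OF K, of S]
    by (simp add: op_le_def positive_extensions_iff extends_def)
  ultimately show ?thesis by (auto simp: is_least_op_def positive_extensions_iff)
qed

lemma krein_von_neumann_is_least:
  assumes "w_star_sequentially_complete pair" "subpositive scaleE scaleF pair D A"
  shows "is_least_op pair (positive_extensions scaleE scaleF pair D A)
           (krein_von_neumann scaleE scaleF pair D A)"
proof -
  have "\<exists>!K. is_least_op pair (positive_extensions scaleE scaleF pair D A) K"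
  proof (rule ex_ex1I)
    fix S T
    assume "is_least_op pair (positive_extensions scaleE scaleF pair D A) S"
      and "is_least_op pair (positive_extensions scaleE scaleF pair D A) T"
    then show "S = T"
      by (intro op_le_antisym) (simp_all add: is_least_op_def positive_extensions_def)
  qed (rule krein_von_neumann_exists[OF assms])
  from theI'[OF this] show ?thesis unfolding krein_von_neumann_def .
qed

section \<open>The reflection \<open>T \<mapsto> B - T\<close> and order intervals\<close>

lemma linear_operator_on_diff:
  assumes "Vector_Spaces.linear scaleE scaleF B" "linear_operator_on scaleE scaleF D A"
  shows "linear_operator_on scaleE scaleF D (\<lambda>x. B x - A x)"
  using assms(2)
  by (simp add: linear_operator_on_def linear_operatorD[OF assms(1)] F.scale_right_diff_distrib)

lemma subpositive_diff:
  assumes "linear_operator_on scaleE scaleF D A"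
    and "B \<in> continuous_operators scaleE scaleF pair" "T \<in> continuous_operators scaleE scaleF pair"
    and "op_le pair T B" "extends D A T"
  shows "(\<lambda>x. B x - T x) \<in> positive_extensions scaleE scaleF pair D (\<lambda>x. B x - A x)"
    and "subpositive scaleE scaleF pair D (\<lambda>x. B x - A x)"
proof -
  show 1: "(\<lambda>x. B x - T x) \<in> positive_extensions scaleE scaleF pair D (\<lambda>x. B x - A x)"
    using positive_operator_diff[OF assms(3,2,4)] assms(5)
    by (simp add: positive_extensions_iff extends_def)
  with linear_operator_on_diff assms(1,2) show "subpositive scaleE scaleF pair D (\<lambda>x. B x - A x)"
    by (auto simp: subpositive_def continuous_operators_def)
qed

text \<open>On \<open>D\<close> the form of \<open>S - R\<close> is squeezed between 0 and that of
  \<open>T - R\<close>, which vanishes there.\<close>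

lemma extends_between:
  assumes "R \<in> continuous_operators scaleE scaleF pair" "S \<in> continuous_operators scaleE scaleF pair"
    and "op_le pair R S" "op_le pair S T" "extends D A R" "extends D A T"
  shows "extends D A S"
  unfolding extends_def
proof
  interpret positive_operator scaleE scaleF pair "\<lambda>x. S x - R x"
    by (rule positive_operator_diff) fact+
  fix x assume "x \<in> D"
  then have "R x = A x" "T x = R x" using assms(5,6) by (auto simp: extends_def)
  then have "q x = 0"
    using assms(3,4)[unfolded op_le_def, rule_format, of x] unfolding q_def
    by (auto simp: complex_nonneg_Reals_iff pair_diff_left)
  with eq_0_if_q_eq_0[of x] \<open>R x = A x\<close> show "S x = A x" by simp
qed

end

section \<open>The largest extension below \<open>B\<close> and the interval of extensions\<close>

theorem theorem3p2:
  fixes scaleE :: "complex \<Rightarrow> 'e::ab_group_add \<Rightarrow> 'e"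
    and scaleF :: "complex \<Rightarrow> 'f::ab_group_add \<Rightarrow> 'f"
    and pair :: "'f \<Rightarrow> 'e \<Rightarrow> complex"
    and D :: "'e set" and A A\<^sub>N B :: "'e \<Rightarrow> 'f"
  assumes "anti_dual_pair scaleE scaleF pair"
    and "w_star_sequentially_complete pair"
    and "subpositive scaleE scaleF pair D A"
    and "A\<^sub>N = krein_von_neumann scaleE scaleF pair D A"
    and "B \<in> continuous_operators scaleE scaleF pair"
    and "positive_on pair UNIV B"
    and "op_le pair A\<^sub>N B"
  shows "\<exists>Amax \<in> continuous_operators scaleE scaleF pair.
    positive_on pair UNIV Amax \<and> op_le pair Amax B \<and>
    (\<forall>T \<in> positive_extensions scaleE scaleF pair D A. op_le pair T B \<longrightarrow> op_le pair T Amax) \<and>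
    is_greatest_op pair
      {T \<in> continuous_operators scaleE scaleF pair.
         op_le pair (\<lambda>x. 0) T \<and> op_le pair T B \<and> extends D A T} Amax \<and>
    (\<forall>T \<in> continuous_operators scaleE scaleF pair.
       op_le pair (\<lambda>x. 0) T \<and> op_le pair T B \<longrightarrow>
         (extends D A T \<longleftrightarrow> op_le pair A\<^sub>N T \<and> op_le pair T Amax)) \<and>
    {T \<in> continuous_operators scaleE scaleF pair. op_le pair A\<^sub>N T \<and> op_le pair T Amax} =
      {T \<in> continuous_operators scaleE scaleF pair.
         op_le pair (\<lambda>x. 0) T \<and> op_le pair T B \<and> extends D A T}"
proof -
  interpret anti_dual_pair scaleE scaleF pair by fact
  let ?L = "continuous_operators scaleE scaleF pair"
  let ?I = "{T \<in> ?L. op_le pair (\<lambda>x. 0) T \<and> op_le pair T B \<and> extends D A T}"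
  have A: "linear_operator_on scaleE scaleF D A" using assms(3) by (simp add: subpositive_def)
  have AN: "A\<^sub>N \<in> ?L" "positive_on pair UNIV A\<^sub>N" "extends D A A\<^sub>N"
    and AN_least: "\<And>T. T \<in> positive_extensions scaleE scaleF pair D A \<Longrightarrow> op_le pair A\<^sub>N T"
    using krein_von_neumann_is_least[OF assms(2,3)] assms(4)
    by (auto simp: is_least_op_def positive_extensions_def)
  have pos_iff: "op_le pair (\<lambda>x. 0) T \<longleftrightarrow> positive_on pair UNIV T" for T
    by (simp add: op_le_def positive_on_def)
  define K where "K = krein_von_neumann scaleE scaleF pair D (\<lambda>x. B x - A x)"
  define Amax where "Amax = (\<lambda>x. B x - K x)"
  \<comment> \<open>Subpositivity of \<open>B - A\<close> on \<open>D\<close> is witnessed by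
    \<open>B - A\<^sub>N\<close>; this is where \<open>A\<^sub>N \<le> B\<close> enters.\<close>
  have least: "is_least_op pair (positive_extensions scaleE scaleF pair D (\<lambda>x. B x - A x)) K"
    unfolding K_def
    using assms(2) subpositive_diff(2)[OF A assms(5) AN(1) assms(7) AN(3)]
    by (rule krein_von_neumann_is_least)
  then have K: "K \<in> ?L" "positive_on pair UNIV K" "extends D (\<lambda>x. B x - A x) K"
    by (auto simp: is_least_op_def positive_extensions_def)
  \<comment> \<open>Since \<open>B - T\<close> is a positive extension of \<open>B - A\<close>,
    minimality gives \<open>K \<le> B - T\<close>, which rearranges to
    \<open>T \<le> B - K\<close>.\<close>
  have Amax_ge: "op_le pair T Amax" if "T \<in> ?L" "op_le pair T B" "extends D A T" for T
    using least subpositive_diff(1)[OF A assms(5) that]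
    by (auto simp: is_least_op_def op_le_def Amax_def algebra_simps)
  have AN_Amax: "op_le pair A\<^sub>N Amax" using AN assms(7) by (intro Amax_ge)
  have Amax_B: "op_le pair Amax B" using K(2) by (simp add: op_le_def Amax_def positive_on_def)
  \<comment> \<open>\<open>A\<^sub>N\<close> is itself one of the competing extensions, so
    \<open>0 \<le> A\<^sub>N \<le> Amax\<close>.\<close>
  have Amax_pos: "positive_on pair UNIV Amax"
    using op_le_trans[OF _ AN_Amax, of "\<lambda>x. 0"] AN(2) by (simp add: pos_iff)
  have "Vector_Spaces.linear scaleE scaleF Amax"
    using assms(5) K(1) unfolding Amax_def
    by (intro linear_operator_diff) (auto simp: continuous_operators_def)
  with Amax_pos have Amax: "Amax \<in> ?L"
    using positive_operator_iff[of Amax] anti_dual_pair_axioms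
    by (simp add: positive_operator_def positive_operator_axioms_def)
  have Amax_ext: "extends D A Amax" using K(3) by (simp add: extends_def Amax_def)
  have interval: "T \<in> ?I \<longleftrightarrow> T \<in> ?L \<and> op_le pair A\<^sub>N T \<and> op_le pair T Amax" for T
  proof
    assume "T \<in> ?I"
    then show "T \<in> ?L \<and> op_le pair A\<^sub>N T \<and> op_le pair T Amax"
      using AN_least[of T] Amax_ge[of T] by (simp add: positive_extensions_def pos_iff)
  next
    assume T: "T \<in> ?L \<and> op_le pair A\<^sub>N T \<and> op_le pair T Amax"
    then have "op_le pair (\<lambda>x. 0) T" "op_le pair T B"
      using op_le_trans AN(2) Amax_B pos_iff by blast+
    moreover have "extends D A T"
      using T AN Amax_ext extends_between[of A\<^sub>N T Amax] by blast
    ultimately show "T \<in> ?I" using T by simp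
  qed
  show ?thesis
  proof (intro bexI[of _ Amax] conjI)
    show "\<forall>T\<in>positive_extensions scaleE scaleF pair D A. op_le pair T B \<longrightarrow> op_le pair T Amax"
      using Amax_ge by (simp add: positive_extensions_def)
    show "is_greatest_op pair ?I Amax"
      using Amax Amax_pos Amax_B Amax_ext Amax_ge by (simp add: is_greatest_op_def pos_iff)
    show "\<forall>T\<in>?L. op_le pair (\<lambda>x. 0) T \<and> op_le pair T B \<longrightarrow>
        (extends D A T \<longleftrightarrow> op_le pair A\<^sub>N T \<and> op_le pair T Amax)"
      using interval by blast
    show "{T \<in> ?L. op_le pair A\<^sub>N T \<and> op_le pair T Amax} = ?I"
      using interval by blast
  qed fact+
qed

end
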